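(* If $R$ is an $l$-ring, then the following statements are equivalent: (a) each strictly positive element in $R$ has a multiplicative inverse and $a^2\geq 0$ for every $a$ in $R$; (b) $R$ is a totally ordered skew-field.
   Context: An $l$-ring (lattice-ordered ring) is a ring $R$, not necessarily commutative, with a partial order $\leq$ that is a lattice order, such that $a\leq b$ implies $a+c\leq b+c$ for all $a,b,c\in R$, and $a\geq 0$, $b\geq 0$ imply $ab\geq 0$. An element $a$ is strictly positive if $a>0$. A skew-field (division ring) is a field that is not necessarily commutative; in (b), totally ordered means that the given lattice order on $R$ is a total order.
   Formalization: The l-ring R is assumed to be nonzero: in the zero ring (a) holds vacuously, as there are no strictly positive elements, while (b) fails, because a skew-field has 1 ≠ 0. *)

theory Defs
  imports "HOL-Library.Lattice_Algebras"
begin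

text \<open>
  The \<open>l\<close>-rings are the types of class \<^class>\<open>lattice_ring\<close>. This class extends
  \<^class>\<open>ring\<close>, so neither commutativity nor an identity element is assumed, and it
  states compatibility of multiplication as monotonicity under multiplication by nonnegative
  elements, which in a ring amounts to products of nonnegative elements being nonnegative.
  The operation \<open>abs\<close> it carries is determined by \<open>abs a = sup a (- a)\<close>.

  As no identity is assumed, the class constant \<open>1\<close> is not available, and the existence of an
  identity element is part of what it means to have a multiplicative inverse.
\<close>

definition is_mult_identity :: "'a::ring \<Rightarrow> bool" where
  "is_mult_identity e \<longleftrightarrow> (\<forall>x. e * x = x \<and> x * e = x)"

definition has_mult_inverse :: "'a::ring \<Rightarrow> bool" where
  "has_mult_inverse a \<longleftrightarrow> (\<exists>e b. is_mult_identity e \<and> a * b = e \<and> b * a = e)"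

definition skew_field :: "'a::ring itself \<Rightarrow> bool" where
  "skew_field _ \<longleftrightarrow>
     (\<exists>e::'a. is_mult_identity e \<and> e \<noteq> 0) \<and> (\<forall>a::'a. a \<noteq> 0 \<longrightarrow> has_mult_inverse a)"

definition totally_ordered :: "'a::order itself \<Rightarrow> bool" where
  "totally_ordered _ \<longleftrightarrow> (\<forall>a b::'a. a \<le> b \<or> b \<le> a)"

lemma is_mult_identity_iff_eq_1: "is_mult_identity e \<longleftrightarrow> e = 1" for e :: "'a::ring_1"
  by (metis is_mult_identity_def mult_1 mult_1_right)

lemma has_mult_inverse_iff:
  "has_mult_inverse a \<longleftrightarrow> (\<exists>b. a * b = 1 \<and> b * a = 1)" for a :: "'a::ring_1"
  by (simp add: has_mult_inverse_def is_mult_identity_iff_eq_1)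

lemma skew_field_division_ring: "skew_field TYPE('a::division_ring)"
  unfolding skew_field_def has_mult_inverse_iff is_mult_identity_iff_eq_1
  by (metis left_inverse right_inverse zero_neq_one)

end

theory Submission
  imports Defs
begin

text \<open>
  Only the passage from (a) to (b) needs an idea. Nonnegative squares make inverses of positive
  elements positive, because \<open>c = b * c\<^sup>2\<close> when \<open>c\<close> is inverse to \<open>b\<close>. So multiplication by a positive
  element is an order automorphism, and two disjoint positive elements \<open>x\<close>, \<open>y\<close> can be normalised
  to the disjoint pair \<open>e\<close>, \<open>z = x\<^sup>-\<^sup>1 * y\<close>, where \<open>e\<close> is the identity. The square of \<open>z - e\<close> then gives
  \<open>2 e \<le> z + z\<^sup>-\<^sup>1\<close>, which is impossible for \<open>z > 0\<close> disjoint from \<open>e\<close>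
  (lemma \<open>nonneg_unit_disjoint_identity\<close>). Hence there are no disjoint pairs of strictly positive
  elements. Since \<open>a - inf a b\<close> and \<open>b - inf a b\<close> are always disjoint, one of them vanishes, so the
  order is total. Every nonzero element is then positive or negative, hence invertible.

  Disjointness of nonnegative \<open>x\<close>, \<open>y\<close> is expressed below as: every common lower bound is
  \<open>\<le> 0\<close>.
\<close>

lemma is_mult_identity_unique:
  fixes e e' :: "'a::ring"
  assumes "is_mult_identity e" "is_mult_identity e'"
  shows "e' = e"
  using assms unfolding is_mult_identity_def by metis

lemma has_mult_inverseE:
  fixes a e :: "'a::ring"
  assumes "has_mult_inverse a" "is_mult_identity e"
  obtains b where "a * b = e" "b * a = e"
  using assms is_mult_identity_unique unfolding has_mult_inverse_def by metis

lemma has_mult_inverse_minus: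
  fixes a :: "'a::ring"
  assumes "has_mult_inverse (- a)"
  shows "has_mult_inverse a"
proof -
  obtain e b where "is_mult_identity e" "- a * b = e" "b * - a = e"
    using assms unfolding has_mult_inverse_def by blast
  then have "is_mult_identity e \<and> a * (- b) = e \<and> (- b) * a = e" by simp
  then show ?thesis unfolding has_mult_inverse_def by blast
qed

text \<open>Here \<open>c = b * c\<^sup>2\<close> is a product of nonnegative elements.\<close>

lemma right_inverse_nonneg:
  fixes b c e :: "'a::lattice_ring"
  assumes e: "is_mult_identity e" and bc: "b * c = e" and "0 \<le> b" and "0 \<le> c * c"
  shows "0 \<le> c"
proof -
  have "b * (c * c) = c"
    using e bc by (simp add: is_mult_identity_def flip: mult.assoc)
  then show ?thesis using mult_nonneg_nonneg[OF assms(3,4)] by simp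
qed

text \<open>
  Dividing \<open>(z - e)\<^sup>2 \<ge> 0\<close> by \<open>z\<close> gives \<open>e - w \<le> z - e \<le> z\<close>, where \<open>w\<close> is the inverse of \<open>z\<close>. As also
  \<open>e - w \<le> e\<close>, disjointness gives \<open>e \<le> w\<close>, that is \<open>z \<le> e\<close>; but then \<open>z\<close> is itself a common lower
  bound of \<open>e\<close> and \<open>z\<close>.
\<close>

lemma nonneg_unit_disjoint_identity:
  fixes e z w :: "'a::lattice_ring"
  assumes e: "is_mult_identity e" and zw: "z * w = e" and wz: "w * z = e"
    and z: "0 \<le> z" and sq: "\<And>a::'a. 0 \<le> a * a"
    and disj: "\<And>p. p \<le> e \<Longrightarrow> p \<le> z \<Longrightarrow> p \<le> 0"
  shows "z = 0"
proof -
  have id: "e * x = x" "x * e = x" for x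
    using e by (auto simp: is_mult_identity_def)
  have "0 \<le> e" using sq[of e] by (simp add: id)
  have "0 \<le> w" using right_inverse_nonneg[OF e zw z sq] .
  have wzz: "w * (z * z) = z" using wz by (simp add: id flip: mult.assoc)
  have "0 \<le> w * ((z - e) * (z - e))"
    by (rule mult_nonneg_nonneg[OF \<open>0 \<le> w\<close> sq])
  also have "w * ((z - e) * (z - e)) = z - e - (e - w)"
    by (simp add: left_diff_distrib right_diff_distrib id wz wzz)
  finally have "e - w \<le> z - e" by simp
  also have "\<dots> \<le> z" using \<open>0 \<le> e\<close> by simp
  finally have "e - w \<le> 0" using \<open>0 \<le> w\<close> by (intro disj) simp_all
  then have "z * e \<le> z * w" using z by (simp add: mult_left_mono)
  then have "z \<le> e" by (simp add: id zw)
  then show "z = 0" using disj[of z] z by simp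
qed

text \<open>
  Multiplication by \<open>x\<close> preserves order and carries the pair \<open>e\<close>, \<open>x\<^sup>-\<^sup>1 * y\<close> to the pair \<open>x\<close>, \<open>y\<close>, so
  disjointness passes to the former pair.
\<close>

lemma no_disjoint_strictly_positive:
  fixes x y :: "'a::lattice_ring"
  assumes inv: "\<And>a::'a. 0 < a \<Longrightarrow> has_mult_inverse a" and sq: "\<And>a::'a. 0 \<le> a * a"
    and x: "0 < x" and y: "0 < y"
    and disj: "\<And>p. p \<le> x \<Longrightarrow> p \<le> y \<Longrightarrow> p \<le> 0"
  shows False
proof -
  obtain e u where e: "is_mult_identity e" and xu: "x * u = e" and ux: "u * x = e"
    using inv[OF x] unfolding has_mult_inverse_def by blast
  have id: "e * a = a" "a * e = a" for a
    using e by (auto simp: is_mult_identity_def)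
  have u: "0 \<le> u" using right_inverse_nonneg[OF e xu _ sq] x by simp
  define z where "z = u * y"
  have xz: "x * z = y" unfolding z_def using xu by (simp add: id flip: mult.assoc)
  have "0 \<le> z" using u y by (simp add: z_def)
  moreover have "z \<noteq> 0" using xz y by auto
  ultimately have "0 < z" by simp
  then obtain w where w: "z * w = e" "w * z = e"
    using has_mult_inverseE[OF inv e] by blast
  have "p \<le> 0" if "p \<le> e" "p \<le> z" for p
  proof -
    have "x * p \<le> x * e" "x * p \<le> x * z"
      using that x by (auto intro: mult_left_mono)
    then have "x * p \<le> 0" using disj by (simp add: id xz)
    then have "u * (x * p) \<le> 0" using u by (rule mult_nonneg_nonpos[rotated])
    then show ?thesis using ux by (simp add: id flip: mult.assoc)
  qed
  then have "z = 0"
    by (rule nonneg_unit_disjoint_identity[OF e w \<open>0 \<le> z\<close> sq])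
  then show False using \<open>z \<noteq> 0\<close> by simp
qed

lemma total_if_no_disjoint_strictly_positive:
  fixes a b :: "'a::lattice_ring"
  assumes "\<And>x y::'a. 0 < x \<Longrightarrow> 0 < y \<Longrightarrow> (\<And>p. p \<le> x \<Longrightarrow> p \<le> y \<Longrightarrow> p \<le> 0) \<Longrightarrow> False"
  shows "a \<le> b \<or> b \<le> a"
proof (rule ccontr)
  assume "\<not> ?thesis"
  then have "inf a b \<noteq> a" "inf a b \<noteq> b" by (metis inf.cobounded2, metis inf.cobounded1)
  then have "inf a b < a" "inf a b < b" by (auto simp: less_le)
  then have pos: "0 < a - inf a b" "0 < b - inf a b" by (simp_all only: diff_gt_0_iff_gt)
  have "p \<le> 0" if "p \<le> a - inf a b" "p \<le> b - inf a b" for p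
  proof -
    have "p + inf a b \<le> inf a b" using that by (intro le_infI) (simp_all only: le_diff_eq)
    then show ?thesis by (simp only: add_le_same_cancel2)
  qed
  then show False using assms[OF pos] by blast
qed

theorem theorem2p2:
  assumes nontrivial: "\<exists>x::'a::lattice_ring. x \<noteq> 0"
  shows "((\<forall>a::'a. 0 < a \<longrightarrow> has_mult_inverse a) \<and> (\<forall>a::'a. 0 \<le> a * a))
     \<longleftrightarrow> (skew_field TYPE('a) \<and> totally_ordered TYPE('a))"
proof
  assume "(\<forall>a::'a. 0 < a \<longrightarrow> has_mult_inverse a) \<and> (\<forall>a::'a. 0 \<le> a * a)"
  then have inv: "\<And>a::'a. 0 < a \<Longrightarrow> has_mult_inverse a" and sq: "\<And>a::'a. 0 \<le> a * a" by auto
  have total: "a \<le> b \<or> b \<le> a" for a b :: 'a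
    using no_disjoint_strictly_positive[OF inv sq] by (rule total_if_no_disjoint_strictly_positive)
  have unit: "has_mult_inverse a" if "a \<noteq> 0" for a :: 'a
  proof -
    have "0 < a \<or> 0 < - a" using total[of 0 a] that by (auto simp: less_le)
    then show ?thesis using inv has_mult_inverse_minus by blast
  qed
  obtain x :: 'a where x: "x \<noteq> 0" using nontrivial by blast
  then obtain e :: 'a where e: "is_mult_identity e"
    using unit unfolding has_mult_inverse_def by blast
  then have "e * x = x" by (simp add: is_mult_identity_def)
  then have "e \<noteq> 0" using x by auto
  then show "skew_field TYPE('a) \<and> totally_ordered TYPE('a)"
    unfolding skew_field_def totally_ordered_def using e unit total by blast
next
  assume "skew_field TYPE('a) \<and> totally_ordered TYPE('a)"
  then have unit: "\<And>a::'a. a \<noteq> 0 \<Longrightarrow> has_mult_inverse a" and total: "\<And>a b::'a. a \<le> b \<or> b \<le> a"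
    unfolding skew_field_def totally_ordered_def by auto
  have "0 \<le> a * a" for a :: 'a
    using total[of 0 a] by (auto intro: mult_nonneg_nonneg mult_nonpos_nonpos)
  then show "(\<forall>a::'a. 0 < a \<longrightarrow> has_mult_inverse a) \<and> (\<forall>a::'a. 0 \<le> a * a)"
    using unit by auto
qed

end
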